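(* Let $G$ be a finite simple graph with $k$ vertices, labeled $1,\dots,k$, and for $n\ge 1$ let $G_n = G \times P_n$ be the Cartesian product of $G$ with the path $P_n$ on $n$ vertices; write the vertices of $G_n$ as $(i,j)$ with $i\in[k]$, $j\in[n]$. Let $P_1, P_2,\dots,P_{B_k}$ be the set partitions of $[k]=\{1,\dots,k\}$ listed in the ordering described in the context (so $P_1=\{[k]\}$ is the one-block partition), where $B_k$ is the $k$-th Bell number. Then there exist a $B_k\times B_k$ matrix $M$ and a vector $v$ of length $B_k$, both with integer entries (and depending only on $G$), such that for all $n\ge 1$ \[ T_n = (M^n v)[1], \] where $T_n$ is the number of spanning trees of $G_n$ and $x[i]$ denotes the $i$-th entry of a vector $x$. Furthermore, for each $i$, $(M^n v)[i]$ equals the number of spanning forests of $G_n$ that are consistent with $P_i$.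
   Context: The Cartesian product $G\times H$ has vertex set $V(G)\times V(H)$, with $(a,b)$ adjacent to $(a',b')$ iff either $a=a'$ and $bb'\in E(H)$, or $b=b'$ and $aa'\in E(G)$. Ordering of partitions: for partitions $Q_1,Q_2$ of $[k]$, let $X_i$ (resp. $Y_i$) be the block of $Q_1$ (resp. $Q_2$) containing $i$, and let $j$ be the least $i$ with $X_i\ne Y_i$; then $Q_1<Q_2$ iff $|Q_1|<|Q_2|$ (fewer blocks), or $|Q_1|=|Q_2|$ and $X_j$ precedes $Y_j$ in the usual lexicographic order. For a spanning forest $\mathcal F$ of $G_n$, the partition induced by $\mathcal F$ is the partition of $[k]$ given by $i\sim j$ iff the vertices $(i,n)$ and $(j,n)$ (in the last copy of $G$) lie in the same tree of $\mathcal F$. A spanning forest $\mathcal F$ of $G_n$ is consistent with a partition $P$ of $[k]$ if $\mathcal F$ has exactly $|P|$ trees and $P$ is the partition induced by $\mathcal F$. *)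

theory Defs
  imports
    "Jordan_Normal_Form.Matrix"
    "HOL-Library.Disjoint_Sets"
begin

section \<open>Undirected simple graphs, forests and trees\<close>

record 'a ugraph =
  verts :: "'a set"
  edges :: "'a set set"

definition simple_graph :: "'a ugraph \<Rightarrow> bool" where
  "simple_graph G \<longleftrightarrow>
     finite (verts G) \<and>
     edges G \<subseteq> {{u, v} | u v. u \<in> verts G \<and> v \<in> verts G \<and> u \<noteq> v}"

definition adj :: "'a ugraph \<Rightarrow> 'a \<Rightarrow> 'a \<Rightarrow> bool" where
  "adj G u v \<longleftrightarrow> {u, v} \<in> edges G"

text \<open>A cycle is given by its vertices in cyclic order, without repetition.\<close>

definition is_cycle :: "'a ugraph \<Rightarrow> 'a list \<Rightarrow> bool" where
  "is_cycle G p \<longleftrightarrow>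
     length p \<ge> 3 \<and> distinct p \<and> successively (adj G) p \<and> adj G (last p) (hd p)"

definition acyclic_graph :: "'a ugraph \<Rightarrow> bool" where
  "acyclic_graph G \<longleftrightarrow> (\<nexists>p. is_cycle G p)"

definition same_component :: "'a ugraph \<Rightarrow> 'a \<Rightarrow> 'a \<Rightarrow> bool" where
  "same_component G u v \<longleftrightarrow> u \<in> verts G \<and> v \<in> verts G \<and> (adj G)\<^sup>*\<^sup>* u v"

definition connected_graph :: "'a ugraph \<Rightarrow> bool" where
  "connected_graph G \<longleftrightarrow>
     verts G \<noteq> {} \<and> (\<forall>u\<in>verts G. \<forall>v\<in>verts G. same_component G u v)"

text \<open>The vertex sets of the connected components; for a forest, of its trees.\<close>

definition components :: "'a ugraph \<Rightarrow> 'a set set" where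
  "components G = verts G // {(u, v). same_component G u v}"

definition spanning_subgraph :: "'a ugraph \<Rightarrow> 'a ugraph \<Rightarrow> bool" where
  "spanning_subgraph H G \<longleftrightarrow> verts H = verts G \<and> edges H \<subseteq> edges G"

definition spanning_forest :: "'a ugraph \<Rightarrow> 'a ugraph \<Rightarrow> bool" where
  "spanning_forest F G \<longleftrightarrow> spanning_subgraph F G \<and> acyclic_graph F"

definition spanning_tree :: "'a ugraph \<Rightarrow> 'a ugraph \<Rightarrow> bool" where
  "spanning_tree T G \<longleftrightarrow> spanning_subgraph T G \<and> connected_graph T \<and> acyclic_graph T"


section \<open>Cartesian products and paths\<close>

definition cartesian_product :: "'a ugraph \<Rightarrow> 'b ugraph \<Rightarrow> ('a \<times> 'b) ugraph" where
  "cartesian_product G H =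
     \<lparr> verts = verts G \<times> verts H,
       edges = {{(a, b), (a', b')} | a b a' b'.
                  a \<in> verts G \<and> a' \<in> verts G \<and> b \<in> verts H \<and> b' \<in> verts H \<and>
                  (a = a' \<and> {b, b'} \<in> edges H \<or> b = b' \<and> {a, a'} \<in> edges G)} \<rparr>"

definition path_graph :: "nat \<Rightarrow> nat ugraph" where
  "path_graph n = \<lparr> verts = {1..n}, edges = {{i, i + 1} | i. 1 \<le> i \<and> i < n} \<rparr>"


section \<open>The ordered list of set partitions\<close>

definition Bell :: "nat \<Rightarrow> nat" where
  "Bell k = card {P. partition_on {1..k} P}"

definition block :: "nat set set \<Rightarrow> nat \<Rightarrow> nat set" where
  "block Q i = (THE X. X \<in> Q \<and> i \<in> X)"

text \<open>
  Sets of numbers are compared lexicographically as increasing sequences, where a proper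
  prefix comes first: \<open>{1} < {1, 2} < {1, 2, 3} < {1, 3}\<close>.
\<close>

definition set_lex_less :: "nat set \<Rightarrow> nat set \<Rightarrow> bool" where
  "set_lex_less X Y \<longleftrightarrow> (sorted_list_of_set X, sorted_list_of_set Y) \<in> lexord less_than"

definition partition_less :: "nat \<Rightarrow> nat set set \<Rightarrow> nat set set \<Rightarrow> bool" where
  "partition_less k Q\<^sub>1 Q\<^sub>2 \<longleftrightarrow>
     card Q\<^sub>1 < card Q\<^sub>2 \<or>
     card Q\<^sub>1 = card Q\<^sub>2 \<and>
     (\<exists>j\<in>{1..k}. (\<forall>i\<in>{1..<j}. block Q\<^sub>1 i = block Q\<^sub>2 i) \<and>
        block Q\<^sub>1 j \<noteq> block Q\<^sub>2 j \<and> set_lex_less (block Q\<^sub>1 j) (block Q\<^sub>2 j))"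

text \<open>Positions in this list start from 0; \<open>set_partitions_sorted\<close> below shows that it is well defined.\<close>

definition set_partitions :: "nat \<Rightarrow> nat set set list" where
  "set_partitions k =
     (THE Ps. set Ps = {P. partition_on {1..k} P} \<and> sorted_wrt (partition_less k) Ps)"


section \<open>Forests consistent with a partition\<close>

text \<open>Here \<open>F\<close> is a spanning forest of the product of a graph on \<open>{1..k}\<close> with the path on \<open>{1..n}\<close>.\<close>

definition induced_partition :: "nat \<Rightarrow> nat \<Rightarrow> (nat \<times> nat) ugraph \<Rightarrow> nat set set" where
  "induced_partition k n F =
     {1..k} // {(i, j). i \<in> {1..k} \<and> j \<in> {1..k} \<and> same_component F (i, n) (j, n)}"

definition consistent :: "nat \<Rightarrow> nat \<Rightarrow> (nat \<times> nat) ugraph \<Rightarrow> nat set set \<Rightarrow> bool" where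
  "consistent k n F P \<longleftrightarrow> card (components F) = card P \<and> P = induced_partition k n F"


section \<open>The list of set partitions is well defined\<close>

lemma finite_set_partitions: "finite {P. partition_on {1..k::nat} P}"
  by (rule finitely_many_partition_on) simp

lemma block_eqI:
  assumes "partition_on A Q" "X \<in> Q" "i \<in> X"
  shows "block Q i = X"
  unfolding block_def
proof (rule the_equality)
  show "X \<in> Q \<and> i \<in> X" using assms by blast
  fix Y assume Y: "Y \<in> Q \<and> i \<in> Y"
  show "Y = X"
    using partition_onD2[OF assms(1)] Y assms(2,3) unfolding disjoint_def by blast
qed

lemma block_in:
  assumes "partition_on A Q" "i \<in> A"
  shows "block Q i \<in> Q" "i \<in> block Q i"
proof -
  obtain X where "X \<in> Q" "i \<in> X"
    using assms partition_onD1 by blast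
  with block_eqI[OF assms(1) this] show "block Q i \<in> Q" "i \<in> block Q i" by auto
qed

lemma partition_eq_blocks:
  assumes "partition_on A Q"
  shows "Q = block Q ` A"
proof
  show "block Q ` A \<subseteq> Q" using block_in[OF assms] by blast
  show "Q \<subseteq> block Q ` A"
  proof
    fix X assume X: "X \<in> Q"
    then have "X \<noteq> {}" using partition_onD3[OF assms] by auto
    then obtain i where i: "i \<in> X" by blast
    then have "i \<in> A" using X partition_onD1[OF assms] by blast
    then show "X \<in> block Q ` A" using block_eqI[OF assms X i] by blast
  qed
qed

lemma set_lex_less_irrefl: "\<not> set_lex_less X X"
  unfolding set_lex_less_def by (rule lexord_irreflexive) simp

lemma set_lex_less_trans: "set_lex_less X Y \<Longrightarrow> set_lex_less Y Z \<Longrightarrow> set_lex_less X Z"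
  unfolding set_lex_less_def by (erule lexord_trans) (auto intro: trans_less_than)

lemma set_lex_less_total:
  assumes "finite X" "finite Y" "X \<noteq> Y"
  shows "set_lex_less X Y \<or> set_lex_less Y X"
proof -
  have "sorted_list_of_set X \<noteq> sorted_list_of_set Y"
    using assms sorted_list_of_set.set_sorted_key_list_of_set by metis
  moreover have "\<forall>a b. (a, b) \<in> less_than \<or> a = b \<or> (b, a) \<in> less_than" by auto
  ultimately show ?thesis
    unfolding set_lex_less_def using lexord_linear by blast
qed

lemma partition_less_irrefl: "\<not> partition_less k Q Q"
  unfolding partition_less_def by blast

lemma partition_less_trans:
  assumes "partition_less k P Q" "partition_less k Q R"
  shows "partition_less k P R"
proof (cases "card P < card Q \<or> card Q < card R")
  case True
  then show ?thesis using assms unfolding partition_less_def by auto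
next
  case False
  with assms have c: "card P = card Q" "card Q = card R"
    unfolding partition_less_def by auto
  obtain a where a: "a \<in> {1..k}" "\<forall>i\<in>{1..<a}. block P i = block Q i"
      "block P a \<noteq> block Q a" "set_lex_less (block P a) (block Q a)"
    using assms(1) c unfolding partition_less_def by (simp only: less_irrefl simp_thms) blast
  obtain b where b: "b \<in> {1..k}" "\<forall>i\<in>{1..<b}. block Q i = block R i"
      "block Q b \<noteq> block R b" "set_lex_less (block Q b) (block R b)"
    using assms(2) c unfolding partition_less_def by (simp only: less_irrefl simp_thms) blast
  let ?m = "min a b"
  have m: "?m \<in> {1..k}" "\<forall>i\<in>{1..<?m}. block P i = block R i"
    using a(1,2) b(1,2) by auto
  have "set_lex_less (block P ?m) (block R ?m)"
  proof (cases a b rule: linorder_cases)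
    case less
    then have "block Q a = block R a" using a(1) b(2) by auto
    then show ?thesis using a(4) less by (simp add: min_def)
  next
    case equal
    then show ?thesis using a(4) b(4) set_lex_less_trans by auto
  next
    case greater
    then have "block P b = block Q b" using b(1) a(2) by auto
    then show ?thesis using b(4) greater by (simp add: min_def)
  qed
  moreover from this have "block P ?m \<noteq> block R ?m"
    using set_lex_less_irrefl by metis
  ultimately have "\<exists>j\<in>{1..k}. (\<forall>i\<in>{1..<j}. block P i = block R i) \<and>
      block P j \<noteq> block R j \<and> set_lex_less (block P j) (block R j)"
    using m by blast
  then show ?thesis using c unfolding partition_less_def by simp
qed

lemma partition_less_total:
  assumes P: "partition_on {1..k} P" and Q: "partition_on {1..k} Q" and "P \<noteq> Q"
  shows "partition_less k P Q \<or> partition_less k Q P"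
proof (cases "card P = card Q")
  case False
  then show ?thesis unfolding partition_less_def by auto
next
  case True
  let ?D = "\<lambda>i. i \<in> {1..k} \<and> block P i \<noteq> block Q i"
  have "\<exists>i. ?D i"
  proof (rule ccontr)
    assume "\<nexists>i. ?D i"
    then have "block P ` {1..k} = block Q ` {1..k}" by (intro image_cong) auto
    then show False using assms(3) partition_eq_blocks[OF P] partition_eq_blocks[OF Q] by simp
  qed
  then have j: "?D (LEAST i. ?D i)" by (rule LeastI_ex)
  define j where "j = (LEAST i. ?D i)"
  have jD: "j \<in> {1..k}" "block P j \<noteq> block Q j" using j unfolding j_def by auto
  have below: "\<forall>i\<in>{1..<j}. block P i = block Q i"
  proof
    fix i assume i: "i \<in> {1..<j}"
    then have "\<not> ?D i" using not_less_Least[of i ?D] unfolding j_def by simp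
    then show "block P i = block Q i" using i jD(1) by auto
  qed
  have "finite (block P j)" "finite (block Q j)"
    using block_in(1)[OF P jD(1)] block_in(1)[OF Q jD(1)] partition_onD1[OF P] partition_onD1[OF Q]
    by (metis Union_upper finite_atLeastAtMost finite_subset)+
  then have "set_lex_less (block P j) (block Q j) \<or> set_lex_less (block Q j) (block P j)"
    using set_lex_less_total jD(2) by blast
  then show ?thesis
  proof
    assume "set_lex_less (block P j) (block Q j)"
    then have "partition_less k P Q"
      using True jD below unfolding partition_less_def by blast
    then show ?thesis ..
  next
    assume "set_lex_less (block Q j) (block P j)"
    moreover have "\<forall>i\<in>{1..<j}. block Q i = block P i" using below by simp
    ultimately have "partition_less k Q P"
      using True[symmetric] jD jD(2)[symmetric] unfolding partition_less_def by blast
    then show ?thesis ..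
  qed
qed

lemma ex_sorted_wrt_list:
  assumes "finite A" "\<And>x y z. r x y \<Longrightarrow> r y z \<Longrightarrow> r x z"
    and "\<And>x y. x \<in> A \<Longrightarrow> y \<in> A \<Longrightarrow> x \<noteq> y \<Longrightarrow> r x y \<or> r y x"
  shows "\<exists>xs. set xs = A \<and> sorted_wrt r xs"
  using assms(1,3)
proof (induction A rule: finite_induct)
  case empty
  then show ?case by simp
next
  case (insert x A)
  then obtain xs where xs: "set xs = A" "sorted_wrt r xs" by auto
  let ?ys = "filter (\<lambda>y. r y x) xs @ x # filter (\<lambda>y. \<not> r y x) xs"
  have 1: "set ?ys = insert x A" using xs(1) by auto
  have 2: "r x y" if "y \<in> A" "\<not> r y x" for y
    using insert.prems[of x y] insert.hyps that by auto
  have "sorted_wrt r ?ys"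
    using xs 2 assms(2) by (auto simp: sorted_wrt_append sorted_wrt_filter)
  with 1 show ?case by blast
qed

lemma sorted_wrt_list_unique:
  assumes "\<And>x. \<not> r x x" "\<And>x y z. r x y \<Longrightarrow> r y z \<Longrightarrow> r x z"
    and "sorted_wrt r xs" "sorted_wrt r ys" "set xs = set ys"
  shows "xs = ys"
  using assms(3-5)
proof (induction xs arbitrary: ys)
  case Nil
  then show ?case by simp
next
  case (Cons x xs)
  then obtain y zs where ys: "ys = y # zs" by (cases ys) auto
  have "x = y"
    using Cons.prems ys assms(1,2) by (metis list.set_intros(1) set_ConsD sorted_wrt.simps(2))
  moreover have "x \<notin> set xs" "y \<notin> set zs"
    using Cons.prems(1,2) ys assms(1) by auto
  ultimately have "set xs = set zs" using Cons.prems(3) ys by auto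
  then show ?case using Cons ys \<open>x = y\<close> by auto
qed

lemma set_partitions_sorted:
  shows "set (set_partitions k) = {P. partition_on {1..k} P}"
    and "sorted_wrt (partition_less k) (set_partitions k)"
proof -
  have "\<exists>!Ps. set Ps = {P. partition_on {1..k} P} \<and> sorted_wrt (partition_less k) Ps"
  proof (rule ex_ex1I)
    show "\<exists>Ps. set Ps = {P. partition_on {1..k} P} \<and> sorted_wrt (partition_less k) Ps"
    proof (rule ex_sorted_wrt_list[OF finite_set_partitions])
      show "partition_less k x z" if "partition_less k x y" "partition_less k y z" for x y z
        using that by (rule partition_less_trans)
      show "partition_less k x y \<or> partition_less k y x"
        if "x \<in> {P. partition_on {1..k} P}" "y \<in> {P. partition_on {1..k} P}" "x \<noteq> y" for x y
        using that by (intro partition_less_total) simp_all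
    qed
  next
    fix Ps Qs
    assume "set Ps = {P. partition_on {1..k} P} \<and> sorted_wrt (partition_less k) Ps"
      and "set Qs = {P. partition_on {1..k} P} \<and> sorted_wrt (partition_less k) Qs"
    then show "Ps = Qs"
      using sorted_wrt_list_unique[of "partition_less k" Ps Qs]
        partition_less_irrefl partition_less_trans by simp
  qed
  from theI'[OF this, folded set_partitions_def]
  show "set (set_partitions k) = {P. partition_on {1..k} P}"
    and "sorted_wrt (partition_less k) (set_partitions k)" by auto
qed

lemma distinct_set_partitions: "distinct (set_partitions k)"
proof -
  have "distinct xs" if "sorted_wrt (partition_less k) xs" for xs
    using that by (induction xs) (auto simp: partition_less_irrefl)
  then show ?thesis using set_partitions_sorted(2) by blast
qed

lemma length_set_partitions: "length (set_partitions k) = Bell k"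
  using distinct_card[OF distinct_set_partitions[of k]] set_partitions_sorted(1)[of k]
  by (simp add: Bell_def)

lemma Bell_pos: "Bell k > 0"
proof -
  have "(\<lambda>i. {i}) ` {1..k} \<in> {P. partition_on {1..k} P}"
    by (auto simp: partition_on_def disjoint_def)
  then show ?thesis
    unfolding Bell_def using finite_set_partitions[of k] card_gt_0_iff by blast
qed

lemma set_partitions_first:
  assumes "k \<ge> 1"
  shows "set_partitions k ! 0 = {{1..k}}"
proof -
  have part: "partition_on {1..k} {{1..k}}"
    using assms by (auto simp: partition_on_def disjoint_def)
  obtain P Ps where PPs: "set_partitions k = P # Ps"
    using length_set_partitions[of k] Bell_pos[of k] by (cases "set_partitions k") auto
  have "P \<in> set (set_partitions k)" unfolding PPs by simp
  then have P: "partition_on {1..k} P" unfolding set_partitions_sorted(1) by (rule CollectD)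
  have "P = {{1..k}}"
  proof (rule ccontr)
    assume neq: "P \<noteq> {{1..k}}"
    have "{{1..k}} \<in> set (set_partitions k)"
      unfolding set_partitions_sorted(1) using part by (rule CollectI)
    then have "{{1..k}} \<in> set Ps" using neq unfolding PPs by simp
    then have "partition_less k P {{1..k}}"
      using set_partitions_sorted(2)[of k] PPs by auto
    then have "card P \<le> 1" unfolding partition_less_def by auto
    moreover have "finite P" using finite_elements[OF _ P] by simp
    moreover have "P \<noteq> {}" using P assms by (auto simp: partition_on_def)
    then have "card P \<noteq> 0" using \<open>finite P\<close> by simp
    ultimately have "card P = 1" by linarith
    then obtain X where "P = {X}" by (auto simp: card_1_singleton_iff)
    then have "P = {{1..k}}" using P by (auto simp: partition_on_def)
    with neq show False ..
  qed
  then show ?thesis using PPs by simp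
qed

end

theory Submission
  imports Defs
begin

text \<open>
  A subgraph of \<open>G\<^sub>n\<^sub>+\<^sub>1\<close> is a subgraph of \<open>G\<^sub>n\<close> together with the edges \<open>A\<close> of the new copy of \<open>G\<close>
  and the edges to the new copy, given by \<open>B \<subseteq> [k]\<close>. A forest is consistent with the partition it induces
  iff every tree meets the last layer. Both this condition on the larger graph and its induced partition
  depend only on \<open>A\<close>, \<open>B\<close> and the partition \<open>Q\<close> induced by the smaller graph: every block of \<open>Q\<close> has to
  meet \<open>B\<close>, and the new partition \<open>P\<close> is generated by \<open>A\<close> and the restriction of \<open>Q\<close> to \<open>B\<close>.
  Acyclicity is the numerical condition that components plus edges equal vertices, so it amounts to
  \<open>|P| + |A| + |B| = |Q| + k\<close>. Counting the admissible pairs \<open>(A, B)\<close> gives the entry of \<open>M\<close> at \<open>(P, Q)\<close>.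
\<close>

section \<open>Forests and the number of components\<close>

text \<open>Reachability refers to a bare edge set, so that graphs on different numbers of layers
  can be compared without adjusting vertex sets.\<close>

definition linked :: "'a set set \<Rightarrow> 'a \<Rightarrow> 'a \<Rightarrow> bool" where
  "linked E = (\<lambda>u v. {u, v} \<in> E)\<^sup>*\<^sup>*"

lemma linked_refl [simp]: "linked E x x"
  by (simp add: linked_def)

lemma linked_trans: "linked E x y \<Longrightarrow> linked E y z \<Longrightarrow> linked E x z"
  by (simp add: linked_def)

lemma linked_edge: "{x, y} \<in> E \<Longrightarrow> linked E x y"
  by (auto simp: linked_def)

lemma linked_step: "linked E x y \<Longrightarrow> {y, z} \<in> E \<Longrightarrow> linked E x z"
  unfolding linked_def by (rule rtranclp.rtrancl_into_rtrancl)

lemma linked_sym: "linked E x y \<Longrightarrow> linked E y x"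
  unfolding linked_def
  by (rule sympD[OF symp_rtranclp]) (auto intro: sympI simp: insert_commute)

lemma linked_mono: "linked E x y \<Longrightarrow> E \<subseteq> E' \<Longrightarrow> linked E' x y"
  unfolding linked_def by (erule rtranclp_mono[THEN predicate2D, rotated]) auto

lemma linked_induct [consumes 1, case_names refl step]:
  assumes "linked E x y" "P x"
    and "\<And>y z. linked E x y \<Longrightarrow> P y \<Longrightarrow> {y, z} \<in> E \<Longrightarrow> P z"
  shows "P y"
  using assms(1) unfolding linked_def
  by (induction rule: rtranclp_induct) (use assms(2,3) in \<open>auto simp: linked_def\<close>)

lemma adj_eq: "adj G = (\<lambda>u v. {u, v} \<in> edges G)"
  by (auto simp: adj_def fun_eq_iff)

lemma same_component_iff:
  "same_component G u v \<longleftrightarrow> u \<in> verts G \<and> v \<in> verts G \<and> linked (edges G) u v"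
  by (simp add: same_component_def linked_def adj_eq)

lemma equiv_linked: "equiv V {(u, v). u \<in> V \<and> v \<in> V \<and> linked E (f u) (f v)}"
  by (intro equivI refl_onI symI transI) (auto intro: linked_sym linked_trans)

text \<open>A walk can be shortened until it crosses the new edge at most once. The disjuncts are no
  crossing and one crossing in either direction.\<close>

lemma linked_insert_iff:
  "linked (insert {u, v} E) x y \<longleftrightarrow>
     linked E x y \<or> linked E x u \<and> linked E v y \<or> linked E x v \<and> linked E u y"
  (is "?L \<longleftrightarrow> ?R y")
proof
  assume ?L
  then show "?R y"
  proof (induction rule: linked_induct)
    case (step y z)
    then consider "{y, z} \<in> E" | "y = u" "z = v" | "y = v" "z = u"
      by (auto simp: doubleton_eq_iff)
    then show ?case
      using step.IH by cases (blast intro: linked_step linked_refl linked_trans linked_sym)+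
  qed simp
next
  have "linked (insert {u, v} E) u v" by (simp add: linked_edge)
  moreover assume "?R y"
  ultimately show ?L
    by (meson linked_mono linked_sym linked_trans subset_insertI)
qed

text \<open>Needed because \<open>is_cycle\<close> forbids repeated vertices. When the walk steps to
  a vertex already on the path, the path is cut back to that vertex.\<close>

lemma linked_imp_distinct_path:
  assumes "linked E u v"
  shows "\<exists>p. p \<noteq> [] \<and> hd p = u \<and> last p = v \<and> distinct p \<and>
    successively (\<lambda>x y. {x, y} \<in> E) p"
  using assms
proof (induction rule: linked_induct)
  case refl
  show ?case by (rule exI[of _ "[u]"]) simp
next
  case (step y z)
  then obtain p where p: "p \<noteq> []" "hd p = u" "last p = y" "distinct p"
    "successively (\<lambda>x y. {x, y} \<in> E) p" by blast
  show ?case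
  proof (cases "z \<in> set p")
    case True
    then obtain as bs where "p = as @ z # bs" by (meson split_list)
    then show ?thesis
      using p by (intro exI[of _ "as @ [z]"]) (auto simp: successively_append_iff hd_append)
  next
    case False
    then show ?thesis
      using p step.hyps by (intro exI[of _ "p @ [z]"]) (auto simp: successively_append_iff)
  qed
qed

lemma successively_imp_linked:
  "successively (\<lambda>x y. {x, y} \<in> E) p \<Longrightarrow> p \<noteq> [] \<Longrightarrow> linked E (hd p) (last p)"
proof (induction p rule: induct_list012)
  case (3 x y zs)
  then show ?case by (auto intro: linked_trans linked_edge)
qed auto

section \<open>Cycles, and acyclicity when an edge is added\<close>

text \<open>Rotation serves to move a chosen edge of a cycle into the closing position from last to
  first vertex.\<close>

lemma is_cycle_rotate1: "is_cycle G p \<Longrightarrow> is_cycle G (rotate1 p)"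
  by (cases p; cases "tl p") (auto simp: is_cycle_def successively_append_iff simp flip: append_Cons)

lemma is_cycle_rotate: "is_cycle G p \<Longrightarrow> is_cycle G (rotate m p)"
  by (induction m) (auto simp: is_cycle_rotate1)

text \<open>The vertex sets are unrelated because \<open>is_cycle\<close> looks only at edges. In
  \<open>forests_Suc\<close> this passes acyclicity from n + 1 layers down to n.\<close>

lemma acyclic_graph_mono:
  assumes "acyclic_graph \<lparr>verts = V', edges = E'\<rparr>" "E \<subseteq> E'"
  shows "acyclic_graph \<lparr>verts = V, edges = E\<rparr>"
proof -
  have "is_cycle \<lparr>verts = V', edges = E'\<rparr> p" if "is_cycle \<lparr>verts = V, edges = E\<rparr> p" for p
  proof -
    have "successively (\<lambda>u v. {u, v} \<in> E') p"
      by (rule successively_mono[of "\<lambda>u v. {u, v} \<in> E"])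
        (use that assms(2) in \<open>auto simp: is_cycle_def adj_eq\<close>)
    then show ?thesis using that assms(2) by (auto simp: is_cycle_def adj_eq)
  qed
  then show ?thesis using assms(1) by (auto simp: acyclic_graph_def)
qed

lemma not_successively_split:
  "\<not> successively P p \<Longrightarrow> \<exists>xs a b ys. p = xs @ a # b # ys \<and> \<not> P a b"
proof (induction p rule: induct_list012)
  case (3 x y zs)
  show ?case
  proof (cases "P x y")
    case True
    with 3 obtain xs a b ys where "y # zs = xs @ a # b # ys" "\<not> P a b" by auto
    then show ?thesis by (metis append_Cons)
  next
    case False
    then show ?thesis by (metis append_Nil)
  qed
qed auto

text \<open>If the new edge closes the cycle, the rest of the cycle is a path in \<open>E\<close>
  between its ends.\<close>

lemma linked_of_closing_edge:
  assumes cyc: "is_cycle \<lparr>verts = V, edges = insert {u, v} E\<rparr> p" and e: "{last p, hd p} = {u, v}"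
  shows "linked E u v"
proof -
  have p: "length p \<ge> 3" "distinct p" "successively (\<lambda>x y. {x, y} \<in> insert {u, v} E) p"
    using cyc by (auto simp: is_cycle_def adj_eq)
  have "successively (\<lambda>x y. {x, y} \<in> E) p"
  proof (rule ccontr)
    assume "\<not> ?thesis"
    then obtain xs a b ys where s: "p = xs @ a # b # ys" "{a, b} \<notin> E"
      using not_successively_split by fast
    then have "{a, b} = {u, v}" using p(3) by (auto simp: successively_append_iff)
    \<comment> \<open>In a distinct list of at least three vertices, no two consecutive entries are
      the first and the last one.\<close>
    then have "{a, b} = {last p, hd p}" using e by simp
    then show False
      using p(1,2) s(1) by (cases xs; cases ys rule: rev_cases) (auto simp: doubleton_eq_iff)
  qed
  moreover have "p \<noteq> []" using p(1) by auto
  ultimately have "linked E (hd p) (last p)" by (rule successively_imp_linked)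
  then show ?thesis using e by (auto simp: doubleton_eq_iff intro: linked_sym)
qed

text \<open>A path in \<open>E\<close> from \<open>u\<close> to \<open>v\<close> and the new edge
  close up to a cycle. Conversely, a cycle that is not in \<open>E\<close> uses the new edge and,
  once rotated so that this edge closes it, yields such a path.\<close>

lemma acyclic_graph_insert_iff:
  assumes "u \<noteq> v" "{u, v} \<notin> E"
  shows "acyclic_graph \<lparr>verts = V, edges = insert {u, v} E\<rparr> \<longleftrightarrow>
    acyclic_graph \<lparr>verts = V, edges = E\<rparr> \<and> \<not> linked E u v" (is "?L \<longleftrightarrow> ?R")
proof
  assume L: ?L
  then have "acyclic_graph \<lparr>verts = V, edges = E\<rparr>" by (rule acyclic_graph_mono) auto
  moreover have "\<not> linked E u v"
  proof
    assume "linked E u v"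
    then obtain p where p: "p \<noteq> []" "hd p = u" "last p = v" "distinct p"
      "successively (\<lambda>x y. {x, y} \<in> E) p" using linked_imp_distinct_path by metis
    obtain x ps where x: "p = x # ps" using p(1) by (cases p) auto
    obtain y qs where y: "ps = y # qs" using p x assms(1) by (cases ps) auto
    \<comment> \<open>A path with only two vertices would be the edge {u, v} itself, which is not in
      \<open>E\<close>.\<close>
    have "qs \<noteq> []" using p x y assms(2) by auto
    then have "length p \<ge> 3" using x y by (cases qs) auto
    moreover have "successively (\<lambda>x y. {x, y} \<in> insert {u, v} E) p"
      by (rule successively_mono[OF p(5)]) auto
    ultimately have "is_cycle \<lparr>verts = V, edges = insert {u, v} E\<rparr> p"
      using p by (auto simp: is_cycle_def adj_eq insert_commute)
    then show False using L by (auto simp: acyclic_graph_def)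
  qed
  ultimately show ?R ..
next
  assume R: ?R
  show ?L unfolding acyclic_graph_def
  proof
    let ?G = "\<lparr>verts = V, edges = insert {u, v} E\<rparr>"
    assume "\<exists>p. is_cycle ?G p"
    then obtain p where p: "is_cycle ?G p" ..
    have "\<not> is_cycle \<lparr>verts = V, edges = E\<rparr> p" using R by (auto simp: acyclic_graph_def)
    then consider "{last p, hd p} \<notin> E" | "\<not> successively (\<lambda>x y. {x, y} \<in> E) p"
      using p by (auto simp: is_cycle_def adj_eq)
    then show False
    proof cases
      case 1
      then have "{last p, hd p} = {u, v}" using p by (auto simp: is_cycle_def adj_eq)
      then show False using linked_of_closing_edge[OF p] R by blast
    next
      case 2
      then obtain xs a b ys where s: "p = xs @ a # b # ys" "{a, b} \<notin> E"
        using not_successively_split by fast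
      then have ab: "{a, b} = {u, v}"
        using p by (auto simp: successively_append_iff is_cycle_def adj_eq)
      \<comment> \<open>The rotation puts \<open>b\<close> first and \<open>a\<close> last, so that
        the new edge closes the cycle.\<close>
      have "is_cycle ?G (rotate (length (xs @ [a])) ((xs @ [a]) @ (b # ys)))"
        using p s(1) by (intro is_cycle_rotate) simp
      then have "is_cycle ?G ((b # ys) @ xs @ [a])" by (simp only: rotate_append)
      then have "linked E u v" by (rule linked_of_closing_edge) (simp add: ab)
      then show False using R by blast
    qed
  qed
qed

section \<open>Counting components\<close>

lemma components_eq:
  "components \<lparr>verts = V, edges = E\<rparr> = V // {(x, y). x \<in> V \<and> y \<in> V \<and> linked E x y}"
  by (simp add: components_def same_component_iff)

lemma components_insert_linked:
  assumes "linked E u v"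
  shows "components \<lparr>verts = V, edges = insert {u, v} E\<rparr> = components \<lparr>verts = V, edges = E\<rparr>"
proof -
  have "linked (insert {u, v} E) x y \<longleftrightarrow> linked E x y" for x y
    unfolding linked_insert_iff using assms by (meson linked_sym linked_trans)
  then show ?thesis by (simp add: components_eq)
qed

text \<open>The components of \<open>u\<close> and \<open>v\<close> fuse into one and all others
  stay as they are.\<close>

lemma card_components_insert_unlinked:
  assumes "finite V" "u \<in> V" "v \<in> V" "\<not> linked E u v"
  shows "card (components \<lparr>verts = V, edges = insert {u, v} E\<rparr>) + 1 =
    card (components \<lparr>verts = V, edges = E\<rparr>)"
proof -
  define C where "C x = {y \<in> V. linked E x y}" for x
  define C' where "C' x = {y \<in> V. linked (insert {u, v} E) x y}" for x
  have comp: "components \<lparr>verts = V, edges = E\<rparr> = C ` V"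
    by (auto simp: components_eq quotient_def C_def)
  have comp': "components \<lparr>verts = V, edges = insert {u, v} E\<rparr> = C' ` V"
    by (auto simp: components_eq quotient_def C'_def)
  have C_eq: "C x = C y \<longleftrightarrow> linked E x y" if "x \<in> V" "y \<in> V" for x y
    using that by (auto simp: C_def intro: linked_trans linked_sym)
  have C': "C' x = (if linked E x u \<or> linked E x v then C u \<union> C v else C x)" for x
    unfolding C'_def C_def linked_insert_iff
    by (auto intro: linked_trans linked_sym)
  have uv: "C u \<noteq> C v" using C_eq assms by blast
  have "C x \<in> {C u, C v} \<longleftrightarrow> linked E x u \<or> linked E x v" if "x \<in> V" for x
    using C_eq that assms(2,3) by auto
  then have "C ` V - {C u, C v} = C ` {x \<in> V. \<not> linked E x u \<and> \<not> linked E x v}"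
    by blast
  moreover have "C' ` V = insert (C u \<union> C v) (C ` {x \<in> V. \<not> linked E x u \<and> \<not> linked E x v})"
  proof
    show "C' ` V \<subseteq> insert (C u \<union> C v) (C ` {x \<in> V. \<not> linked E x u \<and> \<not> linked E x v})"
      by (auto simp: C')
    have "C u \<union> C v = C' u" by (simp add: C')
    then show "insert (C u \<union> C v) (C ` {x \<in> V. \<not> linked E x u \<and> \<not> linked E x v}) \<subseteq> C' ` V"
      using assms(2) by (auto simp: C' image_iff)
  qed
  ultimately have "C' ` V = insert (C u \<union> C v) (C ` V - {C u, C v})" by simp
  \<comment> \<open>The fused component is not an old one, since an old component containing both
    \<open>u\<close> and \<open>v\<close> would link them.\<close>
  moreover have "C u \<union> C v \<notin> C ` V"
  proof
    assume "C u \<union> C v \<in> C ` V"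
    then obtain x where x: "x \<in> V" "C x = C u \<union> C v" by auto
    have "u \<in> C u" "v \<in> C v" using assms(2,3) by (simp_all add: C_def)
    then have "u \<in> C x" "v \<in> C x" unfolding x(2) by blast+
    then have "linked E x u" "linked E x v" by (simp_all add: C_def)
    then show False using assms(4) by (meson linked_sym linked_trans)
  qed
  moreover have "card (C ` V - {C u, C v}) + 2 = card (C ` V)"
  proof -
    have "card {C u, C v} \<le> card (C ` V)" using assms by (intro card_mono) auto
    then show ?thesis using assms uv by (simp add: card_Diff_subset)
  qed
  ultimately show ?thesis using assms(1) by (simp add: comp comp')
qed

text \<open>Edges are added one at a time to an edgeless graph, where components plus edges equal
  vertices. An edge between two components preserves the sum; an edge inside a component raises it
  by one and creates a cycle. The inequality is carried along so that a raised sum cannot equal the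
  number of vertices.\<close>

lemma card_components_edges:
  assumes "finite E" "finite V" "\<forall>e\<in>E. \<exists>u\<in>V. \<exists>v\<in>V. u \<noteq> v \<and> e = {u, v}"
  shows "card V \<le> card (components \<lparr>verts = V, edges = E\<rparr>) + card E \<and>
    (acyclic_graph \<lparr>verts = V, edges = E\<rparr> \<longleftrightarrow>
     card (components \<lparr>verts = V, edges = E\<rparr>) + card E = card V)"
  using assms(1,3)
proof (induction E rule: finite_induct)
  case empty
  have "linked {} x y \<longleftrightarrow> x = y" for x y :: 'a
    by (auto simp: linked_def elim: rtranclp.cases)
  then have "components \<lparr>verts = V, edges = {}\<rparr> = (\<lambda>x. {x}) ` V"
    by (auto simp: components_eq quotient_def)
  moreover have "acyclic_graph \<lparr>verts = V, edges = {}\<rparr>"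
    by (auto simp: acyclic_graph_def is_cycle_def adj_eq)
  ultimately show ?case by (simp add: card_image)
next
  case (insert e E)
  then obtain u v where e: "e = {u, v}" "u \<in> V" "v \<in> V" "u \<noteq> v" by blast
  have IH: "card V \<le> card (components \<lparr>verts = V, edges = E\<rparr>) + card E"
    "acyclic_graph \<lparr>verts = V, edges = E\<rparr> \<longleftrightarrow>
      card (components \<lparr>verts = V, edges = E\<rparr>) + card E = card V"
    using insert by auto
  have ac: "acyclic_graph \<lparr>verts = V, edges = insert e E\<rparr> \<longleftrightarrow>
    acyclic_graph \<lparr>verts = V, edges = E\<rparr> \<and> \<not> linked E u v"
    using acyclic_graph_insert_iff[of u v E V] insert.hyps e by simp
  show ?case
  proof (cases "linked E u v")
    case True
    then show ?thesis
      using IH ac components_insert_linked[OF True, of V] insert.hyps e(1) by auto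
  next
    case False
    then show ?thesis
      using IH ac card_components_insert_unlinked[OF assms(2) e(2,3) False] insert.hyps e(1)
      by auto
  qed
qed

section \<open>Adding a layer\<close>

text \<open>
  In \<open>add_layer n E A B\<close> the set \<open>E\<close> lives on the first \<open>n\<close> layers, \<open>A\<close> consists of edges of \<open>G\<close>, to
  be copied to layer \<open>n + 1\<close>, and \<open>B\<close> of the \<open>i\<close> for which \<open>(i, n)\<close> is joined to \<open>(i, n + 1)\<close>.
\<close>

definition layer_edge :: "nat \<Rightarrow> nat set \<Rightarrow> (nat \<times> nat) set" where
  "layer_edge n e = (\<lambda>a. (a, n)) ` e"

definition rung :: "nat \<Rightarrow> nat \<Rightarrow> (nat \<times> nat) set" where
  "rung n i = {(i, n), (i, Suc n)}"

definition add_layer :: "nat \<Rightarrow> (nat \<times> nat) set set \<Rightarrow> nat set set \<Rightarrow> nat set \<Rightarrow> (nat \<times> nat) set set" where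
  "add_layer n E A B = E \<union> layer_edge (Suc n) ` A \<union> rung n ` B"

definition induced_by :: "nat \<Rightarrow> nat \<Rightarrow> (nat \<times> nat) set set \<Rightarrow> nat set set" where
  "induced_by k n E = {1..k} // {(i, j). i \<in> {1..k} \<and> j \<in> {1..k} \<and> linked E (i, n) (j, n)}"

text \<open>For n >= 1 this is the equality of counts demanded by \<open>consistent\<close>, as
  \<open>card_induced_by_eq_iff\<close> shows.\<close>

definition reaches_last :: "nat \<Rightarrow> nat \<Rightarrow> (nat \<times> nat) set set \<Rightarrow> bool" where
  "reaches_last k n E \<longleftrightarrow> (\<forall>x\<in>{1..k} \<times> {1..n}. \<exists>j\<in>{1..k}. linked E x (j, n))"

definition merged :: "nat set set \<Rightarrow> nat set set \<Rightarrow> nat set \<Rightarrow> nat \<Rightarrow> nat \<Rightarrow> bool" where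
  "merged Q A B = (\<lambda>i j. {i, j} \<in> A \<or> i \<in> B \<and> j \<in> B \<and> (\<exists>X\<in>Q. i \<in> X \<and> j \<in> X))\<^sup>*\<^sup>*"

text \<open>The last equation is the difference of the forest counts for n + 1 layers, with total
  k(n + 1), and for n layers, with total kn. Hence n does not occur in it.\<close>

definition transitions :: "nat \<Rightarrow> nat set set \<Rightarrow> nat set set \<Rightarrow> nat set set \<Rightarrow> (nat set set \<times> nat set) set" where
  "transitions k EG P Q = {(A, B). A \<subseteq> EG \<and> B \<subseteq> {1..k} \<and> (\<forall>X\<in>Q. X \<inter> B \<noteq> {}) \<and>
     P = {1..k} // {(i, j). i \<in> {1..k} \<and> j \<in> {1..k} \<and> merged Q A B i j} \<and>
     card P + card A + card B = card Q + k}"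

lemma layer_edge_doubleton [simp]: "layer_edge n {a, b} = {(a, n), (b, n)}"
  by (simp add: layer_edge_def)

lemma inj_layer_edge: "inj (layer_edge n)"
  unfolding layer_edge_def by (rule inj_on_image) (simp add: inj_on_def)

lemma inj_rung: "inj (rung n)"
  by (rule injI) (auto simp: rung_def doubleton_eq_iff)

lemma layer_edge_eq_doubleton:
  "{x, y} = layer_edge n e \<longleftrightarrow> snd x = n \<and> snd y = n \<and> e = {fst x, fst y}"
proof
  assume "{x, y} = layer_edge n e"
  then have 1: "{x, y} = (\<lambda>a. (a, n)) ` e" by (simp add: layer_edge_def)
  then have "x \<in> (\<lambda>a. (a, n)) ` e" "y \<in> (\<lambda>a. (a, n)) ` e" by auto
  moreover have "fst ` {x, y} = e" unfolding 1 by (simp add: image_image)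
  ultimately show "snd x = n \<and> snd y = n \<and> e = {fst x, fst y}" by auto
next
  assume "snd x = n \<and> snd y = n \<and> e = {fst x, fst y}"
  then show "{x, y} = layer_edge n e" by (cases x; cases y) (simp add: layer_edge_def)
qed

lemma add_layer_edge_iff:
  assumes "\<Union>E \<subseteq> UNIV \<times> {..n}"
  shows "{x, y} \<in> add_layer n E A B \<longleftrightarrow>
    {x, y} \<in> E \<or> snd x = Suc n \<and> snd y = Suc n \<and> {fst x, fst y} \<in> A \<or>
    (\<exists>i\<in>B. x = (i, n) \<and> y = (i, Suc n) \<or> x = (i, Suc n) \<and> y = (i, n))"
  by (auto simp: add_layer_def image_iff layer_edge_eq_doubleton rung_def doubleton_eq_iff)

section \<open>Connectivity after adding a layer\<close>

lemma mem_same_block_iff: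
  assumes "equiv V r" "i \<in> V" "j \<in> V"
  shows "(\<exists>X\<in>V // r. i \<in> X \<and> j \<in> X) \<longleftrightarrow> (i, j) \<in> r"
  using assms
  by (metis equiv_class_self equiv_class_eq_iff quotientI Image_singleton_iff quotient_eq_iff)

text \<open>An excursion of a walk from the new layer into the old ones goes down a rung and comes
  up a rung. Its effect is one step of \<open>merged\<close> between two elements of
  \<open>B\<close> in the same old block.\<close>

lemma linked_add_layer_merged:
  assumes E: "\<Union>E \<subseteq> {1..k} \<times> {..n}" and B: "B \<subseteq> {1..k}"
  shows "linked (add_layer n E A B) (a, Suc n) (b, Suc n) \<longleftrightarrow> merged (induced_by k n E) A B a b"
proof -
  let ?E' = "add_layer n E A B"
  have E': "\<Union>E \<subseteq> UNIV \<times> {..n}" using E by auto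
  note edge = add_layer_edge_iff[OF E']
  have block: "(\<exists>X\<in>induced_by k n E. i \<in> X \<and> j \<in> X) \<longleftrightarrow> linked E (i, n) (j, n)"
    if "i \<in> B" "j \<in> B" for i j
    unfolding induced_by_def
    using that B by (subst mem_same_block_iff[OF equiv_linked]) auto
  have notop: "{x, y} \<in> E \<Longrightarrow> snd x \<noteq> Suc n \<and> snd y \<noteq> Suc n" for x y
    using E' by fastforce
  show ?thesis
  proof
    assume "linked ?E' (a, Suc n) (b, Suc n)"
    \<comment> \<open>Below the new layer the invariant remembers the rung by which the walk last
      descended.\<close>
    moreover have "(snd y = Suc n \<longrightarrow> merged (induced_by k n E) A B a (fst y)) \<and>
      (snd y \<noteq> Suc n \<longrightarrow> (\<exists>i\<in>B. merged (induced_by k n E) A B a i \<and> linked E (i, n) y))"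
      if "linked ?E' (a, Suc n) y" for y
      using that
    proof (induction rule: linked_induct)
      case refl
      show ?case by (simp add: merged_def)
    next
      case (step y z)
      from step.hyps(2) consider "{y, z} \<in> E"
        | "snd y = Suc n" "snd z = Suc n" "{fst y, fst z} \<in> A"
        | i where "i \<in> B" "y = (i, n)" "z = (i, Suc n)"
        | i where "i \<in> B" "y = (i, Suc n)" "z = (i, n)"
        unfolding edge by blast
      then show ?case
      proof cases
        case 1
        then show ?thesis using notop[OF 1] step.IH by (auto intro: linked_step)
      next
        case 2
        then show ?thesis using step.IH
          by (auto simp: merged_def intro: rtranclp.rtrancl_into_rtrancl)
      next
        case 3
        then obtain j where j: "j \<in> B" "merged (induced_by k n E) A B a j" "linked E (j, n) (i, n)"
          using step.IH by auto
        then have "merged (induced_by k n E) A B a i"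
          using block[of j i] 3(1) unfolding merged_def
          by (auto intro: rtranclp.rtrancl_into_rtrancl)
        then show ?thesis using 3 by simp
      next
        case 4
        then show ?thesis using step.IH by auto
      qed
    qed
    ultimately show "merged (induced_by k n E) A B a b" by fastforce
  next
    assume "merged (induced_by k n E) A B a b"
    then show "linked ?E' (a, Suc n) (b, Suc n)"
      unfolding merged_def
    proof (induction rule: rtranclp_induct)
      case (step i j)
      from step.hyps(2) have "linked ?E' (i, Suc n) (j, Suc n)"
      proof
        assume "{i, j} \<in> A"
        then show ?thesis by (intro linked_edge) (simp add: edge)
      next
        assume ij: "i \<in> B \<and> j \<in> B \<and> (\<exists>X\<in>induced_by k n E. i \<in> X \<and> j \<in> X)"
        then have "linked E (i, n) (j, n)" using block by blast
        then have "linked ?E' (i, n) (j, n)" by (rule linked_mono) (auto simp: add_layer_def)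
        moreover have "linked ?E' (i, Suc n) (i, n)" "linked ?E' (j, n) (j, Suc n)"
          using ij by (auto intro!: linked_edge simp: edge)
        ultimately show ?thesis by (meson linked_trans)
      qed
      with step.IH show ?case by (rule linked_trans)
    qed simp
  qed
qed

text \<open>Rungs are the only way from the old layers to the new one. So each old component has to
  contain the foot of a rung, that is, to meet the last old layer in an element of
  \<open>B\<close>.\<close>

lemma reaches_last_add_layer_iff:
  assumes E: "\<Union>E \<subseteq> {1..k} \<times> {..n}" and B: "B \<subseteq> {1..k}" and n: "n \<ge> 1"
  shows "reaches_last k (Suc n) (add_layer n E A B) \<longleftrightarrow>
    reaches_last k n E \<and> (\<forall>X\<in>induced_by k n E. X \<inter> B \<noteq> {})" (is "?L \<longleftrightarrow> ?R")
proof -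
  let ?E' = "add_layer n E A B"
  have E': "\<Union>E \<subseteq> UNIV \<times> {..n}" using E by auto
  note edge = add_layer_edge_iff[OF E']
  have blocks: "(\<forall>X\<in>induced_by k n E. X \<inter> B \<noteq> {}) \<longleftrightarrow>
      (\<forall>i\<in>{1..k}. \<exists>j\<in>B. linked E (i, n) (j, n))"
    using B by (fastforce simp: induced_by_def quotient_def)
  have up: "linked ?E' x y" if "linked E x y" for x y
    using that by (rule linked_mono) (auto simp: add_layer_def)
  have rung: "linked ?E' (j, n) (j, Suc n)" if "j \<in> B" for j
    using that by (auto intro!: linked_edge simp: edge)
  show ?thesis
  proof
    assume ?L
    \<comment> \<open>The walk is followed up to its first rung: either it has stayed in
      \<open>E\<close>, or \<open>E\<close> alone already links \<open>x\<close> to the foot of a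
      rung.\<close>
    have exit: "linked E x y \<and> snd y \<le> n \<or> (\<exists>i\<in>B. linked E x (i, n))"
      if "linked ?E' x y" "snd x \<le> n" for x y
      using that
    proof (induction rule: linked_induct)
      case (step y z)
      then show ?case
        using E' by (fastforce simp: edge intro: linked_step)
    qed auto
    have hit: "\<exists>i\<in>B. linked E x (i, n)" if "x \<in> {1..k} \<times> {1..n}" for x
    proof -
      have "x \<in> {1..k} \<times> {1..Suc n}" using that by auto
      then obtain j where "linked ?E' x (j, Suc n)"
        using \<open>?L\<close> unfolding reaches_last_def by blast
      from exit[OF this] show ?thesis using that by auto
    qed
    show ?R unfolding blocks using hit B n by (fastforce simp: reaches_last_def)
  next
    assume R: ?R
    have "\<exists>j\<in>{1..k}. linked ?E' x (j, Suc n)" if x: "x \<in> {1..k} \<times> {1..Suc n}" for x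
    proof (cases "snd x = Suc n")
      case True
      then show ?thesis using x by (intro bexI[of _ "fst x"]) (auto simp: prod_eq_iff)
    next
      case False
      then have "x \<in> {1..k} \<times> {1..n}" using x by auto
      then obtain i where i: "i \<in> {1..k}" "linked E x (i, n)"
        using R unfolding reaches_last_def by blast
      then obtain j where j: "j \<in> B" "linked E (i, n) (j, n)" using R blocks by blast
      then have "linked ?E' x (j, Suc n)"
        using i by (meson up rung linked_trans)
      then show ?thesis using j B by blast
    qed
    then show ?L unfolding reaches_last_def by blast
  qed
qed

section \<open>Unique decomposition into old edges, new copy of \<open>G\<close> and rungs\<close>

lemma layer_edge_neq_rung: "layer_edge (Suc n) e \<noteq> rung n i"
proof
  assume "layer_edge (Suc n) e = rung n i"
  then have "(i, n) \<in> layer_edge (Suc n) e" by (simp add: rung_def)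
  then show False by (auto simp: layer_edge_def)
qed

lemma layer_edge_notin:
  assumes "\<Union>E \<subseteq> UNIV \<times> {..n}" "e \<noteq> {}"
  shows "layer_edge (Suc n) e \<notin> E"
proof
  assume "layer_edge (Suc n) e \<in> E"
  then have "layer_edge (Suc n) e \<subseteq> UNIV \<times> {..n}" using assms(1) by auto
  then show False using assms(2) by (auto simp: layer_edge_def)
qed

lemma rung_notin: "\<Union>E \<subseteq> UNIV \<times> {..n} \<Longrightarrow> rung n i \<notin> E"
  by (auto simp: rung_def)

text \<open>Reads the three parts back off the union, which gives the injectivity needed in
  \<open>card_forests_Suc\<close>. The empty set is excluded because its \<open>layer_edge\<close>
  is empty again and reveals no layer.\<close>

lemma add_layer_decode:
  assumes "\<Union>E \<subseteq> UNIV \<times> {..n}" "{} \<notin> A"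
  shows "{e \<in> add_layer n E A B. e \<subseteq> UNIV \<times> {..n}} = E"
    and "{e. e \<noteq> {} \<and> layer_edge (Suc n) e \<in> add_layer n E A B} = A"
    and "{i. rung n i \<in> add_layer n E A B} = B"
proof -
  have layer: "layer_edge (Suc n) e \<subseteq> UNIV \<times> {..n} \<longleftrightarrow> e = {}" for e
    by (auto simp: layer_edge_def)
  have rung: "\<not> rung n i \<subseteq> UNIV \<times> {..n}" for i
    by (auto simp: rung_def)
  have E: "e \<subseteq> UNIV \<times> {..n}" if "e \<in> E" for e
    using assms(1) that by auto
  show "{e \<in> add_layer n E A B. e \<subseteq> UNIV \<times> {..n}} = E"
    using E assms(2) by (auto simp: add_layer_def layer rung)
  show "{e. e \<noteq> {} \<and> layer_edge (Suc n) e \<in> add_layer n E A B} = A"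
    using layer_edge_notin[OF assms(1)] assms(2)
    by (auto simp: add_layer_def layer_edge_neq_rung inj_image_mem_iff[OF inj_layer_edge])
  show "{i. rung n i \<in> add_layer n E A B} = B"
    using rung_notin[OF assms(1)] layer_edge_neq_rung[symmetric]
    by (auto simp: add_layer_def inj_image_mem_iff[OF inj_rung])
qed

lemma card_add_layer:
  assumes "\<Union>E \<subseteq> UNIV \<times> {..n}" "{} \<notin> A" "finite E" "finite A" "finite B"
  shows "card (add_layer n E A B) = card E + card A + card B"
proof -
  have 1: "E \<inter> layer_edge (Suc n) ` A = {}"
  proof (intro equals0I, elim IntE imageE)
    fix e f assume "e \<in> E" "f \<in> A" "e = layer_edge (Suc n) f"
    then show False using layer_edge_notin[OF assms(1), of f] assms(2) by auto
  qed
  have 2: "(E \<union> layer_edge (Suc n) ` A) \<inter> rung n ` B = {}"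
    by (auto simp: rung_notin[OF assms(1)] layer_edge_neq_rung[symmetric])
  have "card (layer_edge (Suc n) ` A) = card A" "card (rung n ` B) = card B"
    by (intro card_image inj_on_subset[OF inj_layer_edge] inj_on_subset[OF inj_rung] subset_UNIV)+
  then show ?thesis
    unfolding add_layer_def using assms 1 2 by (simp add: card_Un_disjoint)
qed

section \<open>Counting forests with the transfer matrix\<close>

text \<open>Powers are defined by multiplication on the right, while the recurrence applies the
  newest factor on the left.\<close>

lemma pow_mat_Suc_left:
  assumes A: "(A :: 'a :: semiring_1 mat) \<in> carrier_mat n n"
  shows "A ^\<^sub>m Suc m = A * A ^\<^sub>m m"
proof (induction m)
  case 0
  show ?case using A by simp
next
  case (Suc m)
  have "A ^\<^sub>m Suc (Suc m) = A * A ^\<^sub>m m * A" using Suc.IH by simp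
  also have "\<dots> = A * A ^\<^sub>m Suc m"
    by (simp add: assoc_mult_mat[OF A pow_carrier_mat[OF A] A])
  finally show ?case .
qed

section \<open>Edges of the product with a path\<close>

locale path_product =
  fixes G :: "nat ugraph" and k :: nat
  assumes simple: "simple_graph G" and verts: "verts G = {1..k}" and k: "k \<ge> 1"
begin

definition prod_edges :: "nat \<Rightarrow> (nat \<times> nat) set set" where
  "prod_edges n = edges (cartesian_product G (path_graph n))"

lemma verts_product: "verts (cartesian_product G (path_graph n)) = {1..k} \<times> {1..n}"
  by (simp add: cartesian_product_def path_graph_def verts)

lemma edge_G: "e \<in> edges G \<Longrightarrow> \<exists>u\<in>{1..k}. \<exists>v\<in>{1..k}. u \<noteq> v \<and> e = {u, v}"
  using simple unfolding simple_graph_def verts by blast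

lemma empty_notin_edges: "{} \<notin> edges G"
  using edge_G[of "{}"] by auto

lemma finite_edges_G: "finite (edges G)"
proof (rule finite_subset)
  show "edges G \<subseteq> Pow {1..k}" using simple unfolding simple_graph_def verts by blast
qed simp

lemma mem_prod_edges_iff:
  "e \<in> prod_edges n \<longleftrightarrow> (\<exists>a b a' b'. e = {(a, b), (a', b')} \<and>
     a \<in> {1..k} \<and> a' \<in> {1..k} \<and> b \<in> {1..n} \<and> b' \<in> {1..n} \<and>
     (a = a' \<and> (\<exists>i. {b, b'} = {i, i + 1} \<and> 1 \<le> i \<and> i < n) \<or> b = b' \<and> {a, a'} \<in> edges G))"
  unfolding prod_edges_def cartesian_product_def path_graph_def verts ugraph.simps mem_Collect_eq ..

text \<open>Sorting the edges into copies of \<open>G\<close> and rungs shows that one more path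
  vertex adds exactly one family of each kind.\<close>

lemma prod_edges_eq:
  "prod_edges n = (\<Union>j\<in>{1..n}. layer_edge j ` edges G) \<union> (\<Union>j\<in>{1..<n}. rung j ` {1..k})"
  (is "_ = ?R")
proof
  show "prod_edges n \<subseteq> ?R"
  proof
    fix e assume "e \<in> prod_edges n"
    then obtain a b a' b' where e: "e = {(a, b), (a', b')}"
      "a \<in> {1..k}" "a' \<in> {1..k}" "b \<in> {1..n}" "b' \<in> {1..n}"
      and c: "a = a' \<and> (\<exists>i. {b, b'} = {i, i + 1} \<and> 1 \<le> i \<and> i < n) \<or> b = b' \<and> {a, a'} \<in> edges G"
      unfolding mem_prod_edges_iff by (elim exE conjE)
    from c show "e \<in> ?R"
    proof (elim disjE conjE exE)
      fix i assume "a = a'" "{b, b'} = {i, i + 1}" "1 \<le> i" "i < n"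
      then have "e = rung i a" "i \<in> {1..<n}"
        using e by (auto simp: rung_def doubleton_eq_iff)
      then show ?thesis using e(2) by blast
    next
      assume "b = b'" "{a, a'} \<in> edges G"
      then have "e = layer_edge b {a, a'}" using e by simp
      then show ?thesis using e(4) \<open>{a, a'} \<in> edges G\<close> by blast
    qed
  qed
  show "?R \<subseteq> prod_edges n"
  proof
    fix e assume "e \<in> ?R"
    then consider j f where "j \<in> {1..n}" "f \<in> edges G" "e = layer_edge j f"
      | j i where "j \<in> {1..<n}" "i \<in> {1..k}" "e = rung j i" by blast
    then show "e \<in> prod_edges n"
    proof cases
      case 1
      obtain u v where "u \<in> {1..k}" "v \<in> {1..k}" "f = {u, v}" using edge_G[OF 1(2)] by blast
      with 1 show ?thesis
        unfolding mem_prod_edges_iff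
        by - (rule exI[of _ u], rule exI[of _ j], rule exI[of _ v], rule exI[of _ j], simp)
    next
      case 2
      then show ?thesis
        unfolding mem_prod_edges_iff
        by - (rule exI[of _ i], rule exI[of _ j], rule exI[of _ i], rule exI[of _ "Suc j"],
          auto simp: rung_def)
    qed
  qed
qed

lemma prod_edges_1: "prod_edges 1 = layer_edge 1 ` edges G"
  by (simp add: prod_edges_eq)

lemma prod_edges_Suc:
  assumes "n \<ge> 1"
  shows "prod_edges (Suc n) = add_layer n (prod_edges n) (edges G) {1..k}"
proof -
  have "{1..Suc n} = insert (Suc n) {1..n}" "{1..<Suc n} = insert n {1..<n}" using assms by auto
  then show ?thesis by (simp add: prod_edges_eq add_layer_def Un_ac)
qed

lemma prod_edgeD:
  assumes "e \<in> prod_edges n"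
  shows "\<exists>u\<in>{1..k} \<times> {1..n}. \<exists>v\<in>{1..k} \<times> {1..n}. u \<noteq> v \<and> e = {u, v}"
proof -
  consider j f where "j \<in> {1..n}" "f \<in> edges G" "e = layer_edge j f"
    | j i where "j \<in> {1..<n}" "i \<in> {1..k}" "e = rung j i"
    using assms unfolding prod_edges_eq by (elim UnE UN_E imageE) simp_all
  then show ?thesis
  proof cases
    case 1
    obtain u v where "u \<in> {1..k}" "v \<in> {1..k}" "u \<noteq> v" "f = {u, v}" using edge_G[OF 1(2)] by blast
    with 1 show ?thesis
      by - (rule bexI[of _ "(u, j)"], rule bexI[of _ "(v, j)"], auto)
  next
    case 2
    then show ?thesis
      by - (rule bexI[of _ "(i, j)"], rule bexI[of _ "(i, Suc j)"], auto simp: rung_def)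
  qed
qed

lemma Union_prod_edges:
  assumes "E \<subseteq> prod_edges n"
  shows "\<Union>E \<subseteq> {1..k} \<times> {..n}"
proof (rule Union_least)
  fix e assume "e \<in> E"
  then obtain u v where "u \<in> {1..k} \<times> {1..n}" "v \<in> {1..k} \<times> {1..n}" "e = {u, v}"
    using prod_edgeD[of e n] assms by blast
  then show "e \<subseteq> {1..k} \<times> {..n}" by auto
qed

lemma finite_prod_edges: "finite (prod_edges n)"
  by (simp add: prod_edges_eq finite_edges_G)

section \<open>Consistent forests as a numerical condition\<close>

lemma acyclic_prod_iff:
  assumes "E \<subseteq> prod_edges n"
  shows "acyclic_graph \<lparr>verts = {1..k} \<times> {1..n}, edges = E\<rparr> \<longleftrightarrow>
    card (components \<lparr>verts = {1..k} \<times> {1..n}, edges = E\<rparr>) + card E = k * n"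
proof -
  have "\<forall>e\<in>E. \<exists>u\<in>{1..k} \<times> {1..n}. \<exists>v\<in>{1..k} \<times> {1..n}. u \<noteq> v \<and> e = {u, v}"
    using prod_edgeD assms by blast
  from card_components_edges[OF finite_subset[OF assms finite_prod_edges] _ this]
  show ?thesis by simp
qed

text \<open>Blocks of the induced partition correspond to the components that meet the last layer.
  These form a subset of the finite set of all components, so the counts agree iff every component
  meets that layer.\<close>

lemma card_induced_by_eq_iff:
  assumes "n \<ge> 1"
  shows "card (components \<lparr>verts = {1..k} \<times> {1..n}, edges = E\<rparr>) = card (induced_by k n E) \<longleftrightarrow>
    reaches_last k n E"
proof -
  let ?V = "{1..k} \<times> {1..n}"
  define C where "C x = {y \<in> ?V. linked E x y}" for x
  define L where "L = {1..k} \<times> {n}"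
  have comp: "components \<lparr>verts = ?V, edges = E\<rparr> = C ` ?V"
    by (auto simp: components_eq quotient_def C_def)
  have C_eq: "C x = C y \<longleftrightarrow> linked E x y" if "x \<in> ?V" "y \<in> ?V" for x y
    using that by (auto simp: C_def intro: linked_trans linked_sym)
  have L: "L \<subseteq> ?V" using assms by (auto simp: L_def)
  define D where "D i = {j \<in> {1..k}. linked E (i, n) (j, n)}" for i
  have ind: "induced_by k n E = D ` {1..k}"
    by (auto simp: induced_by_def quotient_def D_def)
  have "D i = (\<lambda>X. {j. (j, n) \<in> X}) (C (i, n))" for i
    using assms by (auto simp: D_def C_def)
  then have "D ` {1..k} = (\<lambda>X. {j. (j, n) \<in> X}) ` (C ` L)"
    by (auto simp: L_def image_iff)
  \<comment> \<open>Two components with the same trace on the last layer share a vertex there and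
    therefore coincide.\<close>
  moreover have "inj_on (\<lambda>X. {j. (j, n) \<in> X}) (C ` L)"
  proof (rule inj_onI)
    fix X Y assume "X \<in> C ` L" "Y \<in> C ` L" and eq: "{j. (j, n) \<in> X} = {j. (j, n) \<in> Y}"
    then obtain i j where ij: "i \<in> {1..k}" "j \<in> {1..k}" "X = C (i, n)" "Y = C (j, n)"
      by (auto simp: L_def)
    then have "(j, n) \<in> Y" using assms by (auto simp: C_def)
    then have "(j, n) \<in> X" using eq by auto
    then show "X = Y" using ij C_eq[of "(i, n)" "(j, n)"] assms by (auto simp: C_def)
  qed
  ultimately have card: "card (induced_by k n E) = card (C ` L)"
    using ind by (simp add: card_image)
  have "C ` L = C ` ?V" if "card (C ` ?V) = card (C ` L)"
    by (rule card_subset_eq[OF _ image_mono[OF L]]) (use that in auto)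
  then have "card (C ` ?V) = card (C ` L) \<longleftrightarrow> C ` L = C ` ?V" by auto
  also have "\<dots> \<longleftrightarrow> C ` ?V \<subseteq> C ` L"
    using image_mono[OF L, of C] by (simp only: set_eq_subset simp_thms)
  also have "\<dots> \<longleftrightarrow> (\<forall>x\<in>?V. \<exists>y\<in>L. C x = C y)" by (simp only: image_subset_iff image_iff)
  also have "\<dots> \<longleftrightarrow> (\<forall>x\<in>?V. \<exists>y\<in>L. linked E x y)"
    by (intro ball_cong bex_cong refl C_eq) (use L in auto)
  also have "\<dots> \<longleftrightarrow> reaches_last k n E" by (simp add: reaches_last_def L_def)
  finally show ?thesis unfolding comp card .
qed

lemma partition_on_induced_by: "partition_on {1..k} (induced_by k n E)"
  unfolding induced_by_def by (rule partition_on_quotient[OF equiv_linked])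

text \<open>Edge sets stand for forests because the vertex set is fixed. Acyclicity appears as the
  count of \<open>card_components_edges\<close>, a form that adds up from layer to layer.\<close>

definition forests :: "nat \<Rightarrow> nat set set \<Rightarrow> (nat \<times> nat) set set set" where
  "forests n P = {E. E \<subseteq> prod_edges n \<and> P = induced_by k n E \<and> reaches_last k n E \<and>
     card P + card E = k * n}"

lemma spanning_subgraph_iff:
  "spanning_subgraph F (cartesian_product G (path_graph n)) \<longleftrightarrow>
    (\<exists>E\<subseteq>prod_edges n. F = \<lparr>verts = {1..k} \<times> {1..n}, edges = E\<rparr>)"
  by (cases F) (auto simp: spanning_subgraph_def verts_product prod_edges_def)

lemma consistent_iff:
  assumes "n \<ge> 1"
  shows "consistent k n \<lparr>verts = {1..k} \<times> {1..n}, edges = E\<rparr> P \<longleftrightarrow>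
    P = induced_by k n E \<and> reaches_last k n E"
proof -
  have "induced_partition k n \<lparr>verts = {1..k} \<times> {1..n}, edges = E\<rparr> = induced_by k n E"
    using assms unfolding induced_partition_def induced_by_def same_component_iff
    by (intro arg_cong[of _ _ "quotient {1..k}"]) auto
  then show ?thesis
    unfolding consistent_def card_induced_by_eq_iff[OF assms, symmetric] by metis
qed

lemma forests_iff_acyclic:
  assumes "n \<ge> 1"
  shows "E \<in> forests n P \<longleftrightarrow> E \<subseteq> prod_edges n \<and> P = induced_by k n E \<and> reaches_last k n E \<and>
    acyclic_graph \<lparr>verts = {1..k} \<times> {1..n}, edges = E\<rparr>"
proof -
  have "acyclic_graph \<lparr>verts = {1..k} \<times> {1..n}, edges = E\<rparr> \<longleftrightarrow>
      card (induced_by k n E) + card E = k * n" if "E \<subseteq> prod_edges n" "reaches_last k n E"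
    unfolding acyclic_prod_iff[OF that(1)] card_induced_by_eq_iff[OF assms, THEN iffD2, OF that(2)] ..
  then show ?thesis unfolding forests_def by blast
qed

lemma consistent_forests_eq:
  assumes "n \<ge> 1"
  shows "{F. spanning_forest F (cartesian_product G (path_graph n)) \<and> consistent k n F P} =
    (\<lambda>E. \<lparr>verts = {1..k} \<times> {1..n}, edges = E\<rparr>) ` forests n P"
proof (intro equalityI subsetI)
  fix F assume "F \<in> {F. spanning_forest F (cartesian_product G (path_graph n)) \<and> consistent k n F P}"
  then obtain E where "E \<subseteq> prod_edges n" and F: "F = \<lparr>verts = {1..k} \<times> {1..n}, edges = E\<rparr>"
    "acyclic_graph F" "consistent k n F P"
    unfolding spanning_forest_def spanning_subgraph_iff by blast
  then have "E \<in> forests n P"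
    unfolding forests_iff_acyclic[OF assms] using consistent_iff[OF assms, of E P] by blast
  then show "F \<in> (\<lambda>E. \<lparr>verts = {1..k} \<times> {1..n}, edges = E\<rparr>) ` forests n P"
    unfolding F(1) by (rule imageI)
next
  fix F assume "F \<in> (\<lambda>E. \<lparr>verts = {1..k} \<times> {1..n}, edges = E\<rparr>) ` forests n P"
  then obtain E where "E \<in> forests n P" "F = \<lparr>verts = {1..k} \<times> {1..n}, edges = E\<rparr>" by blast
  then show "F \<in> {F. spanning_forest F (cartesian_product G (path_graph n)) \<and> consistent k n F P}"
    unfolding forests_iff_acyclic[OF assms] spanning_forest_def spanning_subgraph_iff
    using consistent_iff[OF assms, of E P] by blast
qed

lemma card_consistent_forests:
  assumes "n \<ge> 1"
  shows "card {F. spanning_forest F (cartesian_product G (path_graph n)) \<and> consistent k n F P} =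
    card (forests n P)"
  unfolding consistent_forests_eq[OF assms] by (rule card_image) (rule inj_onI, simp)

text \<open>Connectedness splits into two conditions: every vertex reaches the last layer, and the
  last layer lies in one component. By \<open>consistent_iff\<close> this is consistency with the
  one-block partition.\<close>

lemma spanning_tree_iff:
  assumes "n \<ge> 1"
  shows "spanning_tree T (cartesian_product G (path_graph n)) \<longleftrightarrow>
    spanning_forest T (cartesian_product G (path_graph n)) \<and> consistent k n T {{1..k}}"
proof -
  let ?V = "{1..k} \<times> {1..n}"
  have V: "?V \<noteq> {}" using assms k by auto
  have "connected_graph \<lparr>verts = ?V, edges = E\<rparr> \<longleftrightarrow>
      reaches_last k n E \<and> {{1..k}} = induced_by k n E" for E
  proof
    assume c: "connected_graph \<lparr>verts = ?V, edges = E\<rparr>"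
    then have l: "linked E x y" if "x \<in> ?V" "y \<in> ?V" for x y
      using that by (auto simp: connected_graph_def same_component_iff)
    then have "reaches_last k n E"
      unfolding reaches_last_def using assms k by fastforce
    moreover have "{(i, j). i \<in> {1..k} \<and> j \<in> {1..k} \<and> linked E (i, n) (j, n)} = {1..k} \<times> {1..k}"
      using l assms by auto
    then have "induced_by k n E = {{1..k}}"
      using k by (auto simp: induced_by_def quotient_def)
    ultimately show "reaches_last k n E \<and> {{1..k}} = induced_by k n E" by simp
  next
    assume r: "reaches_last k n E \<and> {{1..k}} = induced_by k n E"
    have "linked E x y" if xy: "x \<in> ?V" "y \<in> ?V" for x y
    proof -
      obtain i j where ij: "i \<in> {1..k}" "j \<in> {1..k}" "linked E x (i, n)" "linked E y (j, n)"
        using r xy unfolding reaches_last_def by meson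
      have "\<exists>X\<in>induced_by k n E. i \<in> X \<and> j \<in> X" using r ij by blast
      then have "linked E (i, n) (j, n)"
        unfolding induced_by_def
        using ij by (subst (asm) mem_same_block_iff[OF equiv_linked]) auto
      then show ?thesis using ij by (meson linked_sym linked_trans)
    qed
    then show "connected_graph \<lparr>verts = ?V, edges = E\<rparr>"
      using V by (auto simp: connected_graph_def same_component_iff)
  qed
  then have "connected_graph \<lparr>verts = ?V, edges = E\<rparr> \<longleftrightarrow>
      consistent k n \<lparr>verts = ?V, edges = E\<rparr> {{1..k}}" for E
    unfolding consistent_iff[OF assms] by blast
  then show ?thesis
    unfolding spanning_tree_def spanning_forest_def spanning_subgraph_iff by blast
qed

section \<open>The recurrence from n to n + 1 layers\<close>

text \<open>Given the two connectivity lemmas, only the counts remain. Building up, the counts of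
  the old forest and of the transition add; taking apart, they subtract.\<close>

lemma forests_Suc:
  assumes n: "n \<ge> 1"
  shows "forests (Suc n) P = (\<lambda>(E, A, B). add_layer n E A B) `
    (\<Union>Q\<in>{Q. partition_on {1..k} Q}. forests n Q \<times> transitions k (edges G) P Q)"
proof -
  have ind: "induced_by k (Suc n) (add_layer n E A B) =
      {1..k} // {(i, j). i \<in> {1..k} \<and> j \<in> {1..k} \<and> merged (induced_by k n E) A B i j}"
    if "E \<subseteq> prod_edges n" "B \<subseteq> {1..k}" for E A B
    unfolding induced_by_def[of k "Suc n"]
    by (simp add: linked_add_layer_merged[OF Union_prod_edges[OF that(1)] that(2)])
  have reach: "reaches_last k (Suc n) (add_layer n E A B) \<longleftrightarrow>
      reaches_last k n E \<and> (\<forall>X\<in>induced_by k n E. X \<inter> B \<noteq> {})"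
    if "E \<subseteq> prod_edges n" "B \<subseteq> {1..k}" for E A B
    by (rule reaches_last_add_layer_iff[OF Union_prod_edges[OF that(1)] that(2) n])
  have card: "card (add_layer n E A B) = card E + card A + card B"
    if "E \<subseteq> prod_edges n" "A \<subseteq> edges G" "B \<subseteq> {1..k}" for E A B
  proof (rule card_add_layer)
    show "\<Union>E \<subseteq> UNIV \<times> {..n}" using Union_prod_edges[OF that(1)] by auto
    show "{} \<notin> A" using empty_notin_edges that(2) by blast
    show "finite E" "finite A" "finite B"
      using that finite_prod_edges finite_edges_G by (auto intro: finite_subset)
  qed
  show ?thesis
  proof (intro equalityI subsetI)
    fix F assume F: "F \<in> forests (Suc n) P"
    then have "F \<subseteq> add_layer n (prod_edges n) (edges G) {1..k}"
      by (simp add: forests_def prod_edges_Suc[OF n])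
    then obtain E A B where EAB: "E \<subseteq> prod_edges n" "A \<subseteq> edges G" "B \<subseteq> {1..k}" "F = add_layer n E A B"
    proof -
      assume sub: "F \<subseteq> add_layer n (prod_edges n) (edges G) {1..k}"
      \<comment> \<open>\<open>A\<close> and \<open>B\<close> index the edges of \<open>F\<close> in
        the new copy of \<open>G\<close> and its rungs leading there.\<close>
      obtain A where A: "A \<subseteq> edges G" "F \<inter> layer_edge (Suc n) ` edges G = layer_edge (Suc n) ` A"
        by (rule subset_imageE[OF Int_lower2])
      obtain B where B: "B \<subseteq> {1..k}" "F \<inter> rung n ` {1..k} = rung n ` B"
        by (rule subset_imageE[OF Int_lower2])
      have "F = add_layer n (F \<inter> prod_edges n) A B"
        unfolding add_layer_def A(2)[symmetric] B(2)[symmetric]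
        using sub unfolding add_layer_def by blast
      then show ?thesis by (rule that[OF Int_lower2 A(1) B(1)])
    qed
    let ?Q = "induced_by k n E"
    have F': "F \<subseteq> prod_edges (Suc n)" "P = induced_by k (Suc n) F" "reaches_last k (Suc n) F"
      "card P + card F = k * Suc n"
      using F by (auto simp: forests_def)
    have R: "reaches_last k n E" "\<forall>X\<in>?Q. X \<inter> B \<noteq> {}"
      using F'(3) reach EAB by auto
    \<comment> \<open>The count for \<open>F\<close> does not by itself give the count for
      \<open>E\<close>. Acyclicity is inherited by the subgraph \<open>E\<close> and supplies it,
      after which the difference is the condition in \<open>transitions\<close>.\<close>
    have "acyclic_graph \<lparr>verts = {1..k} \<times> {1..Suc n}, edges = F\<rparr>"
      using F forests_iff_acyclic[of "Suc n" F P] by simp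
    then have "acyclic_graph \<lparr>verts = {1..k} \<times> {1..n}, edges = E\<rparr>"
      by (rule acyclic_graph_mono) (auto simp: EAB(4) add_layer_def)
    then have E: "E \<in> forests n ?Q"
      unfolding forests_iff_acyclic[OF n] using EAB(1) R(1) by blast
    then have c: "card ?Q + card E = k * n" by (simp add: forests_def)
    have "(A, B) \<in> transitions k (edges G) P ?Q"
      using EAB R(2) F'(2,4) ind card c by (simp add: transitions_def)
    with E have "(E, A, B) \<in> (\<Union>Q\<in>{Q. partition_on {1..k} Q}. forests n Q \<times> transitions k (edges G) P Q)"
      using partition_on_induced_by by blast
    then show "F \<in> (\<lambda>(E, A, B). add_layer n E A B) `
        (\<Union>Q\<in>{Q. partition_on {1..k} Q}. forests n Q \<times> transitions k (edges G) P Q)"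
      by (rule rev_image_eqI) (simp add: EAB(4))
  next
    fix F assume "F \<in> (\<lambda>(E, A, B). add_layer n E A B) `
        (\<Union>Q\<in>{Q. partition_on {1..k} Q}. forests n Q \<times> transitions k (edges G) P Q)"
    then obtain Q E A B where F: "F = add_layer n E A B" and E: "E \<in> forests n Q"
      and AB: "(A, B) \<in> transitions k (edges G) P Q" by auto
    have E': "E \<subseteq> prod_edges n" "Q = induced_by k n E" "reaches_last k n E" "card Q + card E = k * n"
      using E by (auto simp: forests_def)
    have AB': "A \<subseteq> edges G" "B \<subseteq> {1..k}" "\<forall>X\<in>Q. X \<inter> B \<noteq> {}"
      "P = {1..k} // {(i, j). i \<in> {1..k} \<and> j \<in> {1..k} \<and> merged Q A B i j}"
      "card P + card A + card B = card Q + k"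
      using AB by (auto simp: transitions_def)
    have "F \<subseteq> prod_edges (Suc n)"
      unfolding F prod_edges_Suc[OF n] add_layer_def using E'(1) AB'(1,2) by blast
    moreover have "P = induced_by k (Suc n) F"
      using AB'(4) E'(2) unfolding F by (simp only: ind[OF E'(1) AB'(2)])
    moreover have "reaches_last k (Suc n) F"
      unfolding F reach[OF E'(1) AB'(2)] using E' AB'(3) by simp
    moreover have "card P + card F = k * Suc n"
      unfolding F card[OF E'(1) AB'(1,2)] using AB'(5) E'(4) by simp
    ultimately show "F \<in> forests (Suc n) P" by (simp add: forests_def)
  qed
qed

lemma finite_forests: "finite (forests n P)"
  by (rule finite_subset[of _ "Pow (prod_edges n)"]) (auto simp: forests_def finite_prod_edges)

lemma finite_transitions: "finite (transitions k (edges G) P Q)"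
  by (rule finite_subset[of _ "Pow (edges G) \<times> Pow {1..k}"])
    (auto simp: transitions_def finite_edges_G)

text \<open>No forest is counted twice: \<open>add_layer_decode\<close> recovers the triple from the
  union, and its first component determines \<open>Q\<close> as the partition that it
  induces.\<close>

lemma card_forests_Suc:
  assumes "n \<ge> 1"
  shows "card (forests (Suc n) P) =
    (\<Sum>Q | partition_on {1..k} Q. card (transitions k (edges G) P Q) * card (forests n Q))"
proof -
  let ?T = "\<lambda>Q. forests n Q \<times> transitions k (edges G) P Q"
  have "inj_on (\<lambda>(E, A, B). add_layer n E A B) (\<Union>Q\<in>{Q. partition_on {1..k} Q}. ?T Q)"
  proof (rule inj_onI)
    fix x y assume x: "x \<in> (\<Union>Q\<in>{Q. partition_on {1..k} Q}. ?T Q)"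
      and y: "y \<in> (\<Union>Q\<in>{Q. partition_on {1..k} Q}. ?T Q)"
      and eq: "(\<lambda>(E, A, B). add_layer n E A B) x = (\<lambda>(E, A, B). add_layer n E A B) y"
    obtain E A B Q where x': "x = (E, A, B)"
      "E \<in> forests n Q" "(A, B) \<in> transitions k (edges G) P Q"
      using x by auto
    obtain E' A' B' Q' where y': "y = (E', A', B')"
      "E' \<in> forests n Q'" "(A', B') \<in> transitions k (edges G) P Q'"
      using y by auto
    have "\<Union>E \<subseteq> UNIV \<times> {..n}" "\<Union>E' \<subseteq> UNIV \<times> {..n}" "{} \<notin> A" "{} \<notin> A'"
      using x'(2,3) y'(2,3) Union_prod_edges[of E n] Union_prod_edges[of E' n] empty_notin_edges
      unfolding forests_def transitions_def by fast+
    note decode = add_layer_decode[OF this(1,3), of B] add_layer_decode[OF this(2,4), of B']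
    have "add_layer n E A B = add_layer n E' A' B'" using eq by (simp add: x'(1) y'(1))
    then show "x = y" using decode by (simp add: x'(1) y'(1))
  qed
  then have "card (forests (Suc n) P) = card (\<Union>Q\<in>{Q. partition_on {1..k} Q}. ?T Q)"
    unfolding forests_Suc[OF assms] by (rule card_image)
  also have "\<dots> = (\<Sum>Q | partition_on {1..k} Q. card (?T Q))"
  proof (rule card_UN_disjoint[OF finite_set_partitions])
    show "\<forall>Q\<in>{Q. partition_on {1..k} Q}. finite (?T Q)"
      by (simp add: finite_forests finite_transitions)
    show "\<forall>Q\<in>{Q. partition_on {1..k} Q}. \<forall>Q'\<in>{Q. partition_on {1..k} Q}.
        Q \<noteq> Q' \<longrightarrow> ?T Q \<inter> ?T Q' = {}"
      by (auto simp: forests_def)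
  qed
  finally show ?thesis by (simp add: card_cartesian_product mult.commute)
qed

section \<open>The first layer\<close>

text \<open>This partition plays the part of a fictitious layer 0 without edges.\<close>

definition discrete :: "nat set set" where
  "discrete = (\<lambda>i. {i}) ` {1..k}"

lemma partition_on_discrete: "partition_on {1..k} discrete"
  by (auto simp: partition_on_def disjoint_def discrete_def)

text \<open>With singleton blocks, the steps of \<open>merged\<close> that come from blocks do not
  move, so only the edges in \<open>A\<close> remain, whatever \<open>B\<close> is.\<close>

lemma linked_layer_edge_iff:
  assumes "A \<subseteq> edges G"
  shows "linked (layer_edge m ` A) (i, m) (j, m) \<longleftrightarrow> merged discrete A B i j"
proof
  have "snd y = m \<and> merged discrete A B i (fst y)" if "linked (layer_edge m ` A) (i, m) y" for y
    using that
  proof (induction rule: linked_induct)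
    case (step y z)
    then have "snd z = m" "{fst y, fst z} \<in> A"
      by (auto simp: layer_edge_eq_doubleton)
    then show ?case using step.IH by (auto simp: merged_def intro: rtranclp.rtrancl_into_rtrancl)
  qed (simp add: merged_def)
  then show "linked (layer_edge m ` A) (i, m) (j, m) \<Longrightarrow> merged discrete A B i j" by fastforce
  assume "merged discrete A B i j"
  then show "linked (layer_edge m ` A) (i, m) (j, m)"
    unfolding merged_def
  proof (induction rule: rtranclp_induct)
    case (step j l)
    from step.hyps(2) consider "{j, l} \<in> A" | "j = l" by (auto simp: discrete_def)
    then have "linked (layer_edge m ` A) (j, m) (l, m)"
      by cases (auto simp: image_iff layer_edge_eq_doubleton intro!: linked_edge)
    with step.IH show ?case by (rule linked_trans)
  qed simp
qed

text \<open>
  The case \<open>n = 1\<close> is why the initial vector is the unit vector of the discrete partition: every vertex of the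
  old layer must then be joined to the new one, which leaves a forest in the new copy of \<open>G\<close>.
\<close>

lemma card_forests_1: "card (forests 1 P) = card (transitions k (edges G) P discrete)"
proof -
  have "transitions k (edges G) P discrete = (\<lambda>A. (A, {1..k})) ` {A. A \<subseteq> edges G \<and>
      P = {1..k} // {(i, j). i \<in> {1..k} \<and> j \<in> {1..k} \<and> merged discrete A {1..k} i j} \<and>
      card P + card A = k}" (is "_ = _ ` ?S")
  proof -
    have B: "B \<subseteq> {1..k} \<and> (\<forall>X\<in>discrete. X \<inter> B \<noteq> {}) \<longleftrightarrow> B = {1..k}" for B
      by (auto simp: discrete_def)
    have card: "card discrete = k" by (simp add: discrete_def card_image)
    have "(A, B) \<in> transitions k (edges G) P discrete \<longleftrightarrow>
        (B \<subseteq> {1..k} \<and> (\<forall>X\<in>discrete. X \<inter> B \<noteq> {})) \<and> A \<subseteq> edges G \<and>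
        P = {1..k} // {(i, j). i \<in> {1..k} \<and> j \<in> {1..k} \<and> merged discrete A B i j} \<and>
        card P + card A + card B = k + k" for A B
      unfolding transitions_def card by blast
    \<comment> \<open>Since \<open>B\<close> has k elements, the equation reduces to
      \<open>card P + card A = k\<close>, the forest count for a single layer.\<close>
    then have "(A, B) \<in> transitions k (edges G) P discrete \<longleftrightarrow> B = {1..k} \<and> A \<in> ?S" for A B
      unfolding B by auto
    then show ?thesis by auto
  qed
  then have "card (transitions k (edges G) P discrete) = card ?S"
    by (simp add: card_image inj_on_def)
  moreover have "forests 1 P = (`) (layer_edge 1) ` ?S"
  proof -
    have card: "card (layer_edge 1 ` A) = card A" for A
      by (rule card_image) (rule inj_on_subset[OF inj_layer_edge subset_UNIV])
    have ind: "induced_by k 1 (layer_edge 1 ` A) =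
        {1..k} // {(i, j). i \<in> {1..k} \<and> j \<in> {1..k} \<and> merged discrete A {1..k} i j}"
      if "A \<subseteq> edges G" for A
      unfolding induced_by_def linked_layer_edge_iff[OF that, of _ _ _ "{1..k}"] ..
    have reach: "reaches_last k 1 E" for E
      unfolding reaches_last_def by (metis atLeastAtMost_singleton linked_refl mem_Sigma_iff prod.collapse singletonD)
    show ?thesis
    proof (intro equalityI subsetI)
      fix E assume E: "E \<in> forests 1 P"
      then have "E \<subseteq> layer_edge 1 ` edges G" by (simp only: forests_def prod_edges_1 mem_Collect_eq)
      then obtain A where A: "A \<subseteq> edges G" "E = layer_edge 1 ` A" by (rule subset_imageE)
      have P: "P = induced_by k 1 E" "card P + card E = k" using E by (auto simp: forests_def)
      then have "A \<in> ?S" unfolding A(2) ind[OF A(1)] card using A(1) by blast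
      then show "E \<in> (`) (layer_edge 1) ` ?S" unfolding A(2) by (rule imageI)
    next
      fix E assume "E \<in> (`) (layer_edge 1) ` ?S"
      then obtain A where A: "A \<in> ?S" "E = layer_edge 1 ` A" by (rule imageE)
      then have A': "A \<subseteq> edges G"
        "P = {1..k} // {(i, j). i \<in> {1..k} \<and> j \<in> {1..k} \<and> merged discrete A {1..k} i j}"
        "card P + card A = k" by blast+
      have "E \<subseteq> prod_edges 1" unfolding prod_edges_1 A(2) using A'(1) by (rule image_mono)
      moreover have "P = induced_by k 1 E" unfolding A(2) ind[OF A'(1)] by (rule A'(2))
      moreover have "card P + card E = k * 1" unfolding A(2) card using A'(3) by simp
      ultimately show "E \<in> forests 1 P"
        using reach unfolding forests_def by blast
    qed
  qed
  moreover have "inj_on ((`) (layer_edge 1)) ?S"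
    by (rule inj_on_image) (rule inj_on_subset[OF inj_layer_edge subset_UNIV])
  ultimately show ?thesis by (simp add: card_image)
qed

section \<open>The matrix and its powers\<close>

text \<open>Rows belong to the partition after the new layer and columns to the one before it, so
  that the matrix acts on column vectors of counts.\<close>

definition transfer_mat :: "int mat" where
  "transfer_mat = mat (Bell k) (Bell k) (\<lambda>(i, j).
     int (card (transitions k (edges G) (set_partitions k ! i) (set_partitions k ! j))))"

definition initial_vec :: "int vec" where
  "initial_vec = vec (Bell k) (\<lambda>j. if set_partitions k ! j = discrete then 1 else 0)"

lemma sum_set_partitions:
  "(\<Sum>j<Bell k. f (set_partitions k ! j)) = (\<Sum>Q | partition_on {1..k} Q. f Q)"
  by (rule sum.reindex_bij_betw)
    (use bij_betw_nth[OF distinct_set_partitions refl refl, of k]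
      in \<open>simp add: length_set_partitions set_partitions_sorted(1)\<close>)

text \<open>Vectors given by a function of the partition cover both \<open>initial_vec\<close> and
  the vectors of forest counts, so the base case and the step of \<open>transfer_mat_pow\<close>
  both use this.\<close>

lemma transfer_mat_mult_vec:
  "transfer_mat *\<^sub>v vec (Bell k) (\<lambda>j. f (set_partitions k ! j)) =
    vec (Bell k) (\<lambda>i. \<Sum>Q | partition_on {1..k} Q.
      int (card (transitions k (edges G) (set_partitions k ! i) Q)) * f Q)"
proof (rule eq_vecI)
  fix i assume "i < dim_vec (vec (Bell k) (\<lambda>i. \<Sum>Q | partition_on {1..k} Q.
      int (card (transitions k (edges G) (set_partitions k ! i) Q)) * f Q))"
  then have i: "i < Bell k" by simp
  let ?c = "\<lambda>Q. int (card (transitions k (edges G) (set_partitions k ! i) Q)) * f Q"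
  have "(transfer_mat *\<^sub>v vec (Bell k) (\<lambda>j. f (set_partitions k ! j))) $ i =
      (\<Sum>j<Bell k. ?c (set_partitions k ! j))"
    using i by (simp add: transfer_mat_def scalar_prod_def atLeast0LessThan)
  also have "\<dots> = (\<Sum>Q | partition_on {1..k} Q. ?c Q)"
    by (rule sum_set_partitions[of ?c])
  finally show "(transfer_mat *\<^sub>v vec (Bell k) (\<lambda>j. f (set_partitions k ! j))) $ i =
      vec (Bell k) (\<lambda>i. \<Sum>Q | partition_on {1..k} Q.
        int (card (transitions k (edges G) (set_partitions k ! i) Q)) * f Q) $ i"
    using i by simp
qed (simp add: transfer_mat_def)

text \<open>The induction starts at exponent 1, since \<open>initial_vec\<close> belongs to the
  fictitious layer 0 and \<open>card_forests_Suc\<close> requires n >= 1.\<close>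

lemma transfer_mat_pow:
  "transfer_mat ^\<^sub>m Suc n *\<^sub>v initial_vec =
    vec (Bell k) (\<lambda>i. int (card (forests (Suc n) (set_partitions k ! i))))"
proof (induction n)
  case 0
  \<comment> \<open>The unit vector selects the column of \<open>discrete\<close>, whose entries are
    the counts of \<open>card_forests_1\<close>.\<close>
  have "(\<Sum>Q | partition_on {1..k} Q. c Q * (if Q = discrete then 1 else 0)) = c discrete"
    for c :: "nat set set \<Rightarrow> int"
    using partition_on_discrete finite_set_partitions[of k]
    by (simp add: if_distrib[of "(*) _"] sum.delta cong: if_cong)
  then have "transfer_mat *\<^sub>v initial_vec =
      vec (Bell k) (\<lambda>i. int (card (forests 1 (set_partitions k ! i))))"
    unfolding initial_vec_def card_forests_1 by (subst transfer_mat_mult_vec) simp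
  moreover have "transfer_mat ^\<^sub>m Suc 0 = transfer_mat"
    by (simp add: transfer_mat_def)
  ultimately show ?case by simp
next
  case (Suc n)
  have M: "transfer_mat \<in> carrier_mat (Bell k) (Bell k)" by (simp add: transfer_mat_def)
  have v: "initial_vec \<in> carrier_vec (Bell k)" by (simp add: initial_vec_def)
  have "transfer_mat ^\<^sub>m Suc (Suc n) *\<^sub>v initial_vec =
      (transfer_mat * transfer_mat ^\<^sub>m Suc n) *\<^sub>v initial_vec"
    by (simp only: pow_mat_Suc_left[OF M])
  also have "\<dots> = transfer_mat *\<^sub>v (transfer_mat ^\<^sub>m Suc n *\<^sub>v initial_vec)"
    by (rule assoc_mult_mat_vec[OF M pow_carrier_mat[OF M] v])
  also have "\<dots> = vec (Bell k) (\<lambda>i. int (card (forests (Suc (Suc n)) (set_partitions k ! i))))"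
    unfolding Suc.IH
    by (subst transfer_mat_mult_vec[where f = "\<lambda>Q. int (card (forests (Suc n) Q))"])
      (simp add: card_forests_Suc)
  finally show ?case .
qed

end

theorem theorem1:
  fixes G :: "nat ugraph" and k :: nat
  assumes "k \<ge> 1" and "simple_graph G" and "verts G = {1..k}"
  shows "\<exists>(M :: int mat) (v :: int vec).
    M \<in> carrier_mat (Bell k) (Bell k) \<and> v \<in> carrier_vec (Bell k) \<and>
    (\<forall>n\<ge>1.
       int (card {T. spanning_tree T (cartesian_product G (path_graph n))}) = (M ^\<^sub>m n *\<^sub>v v) $ 0 \<and>
       (\<forall>i<Bell k.
          (M ^\<^sub>m n *\<^sub>v v) $ i =
          int (card {F. spanning_forest F (cartesian_product G (path_graph n)) \<and>
                        consistent k n F (set_partitions k ! i)})))"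
proof -
  interpret path_product G k using assms by unfold_locales
  have pow: "(transfer_mat ^\<^sub>m n *\<^sub>v initial_vec) $ i =
      int (card {F. spanning_forest F (cartesian_product G (path_graph n)) \<and>
        consistent k n F (set_partitions k ! i)})"
    if "n \<ge> 1" "i < Bell k" for n i
    using transfer_mat_pow[of "n - 1"] card_consistent_forests[OF that(1)] that by simp
  \<comment> \<open>Position 0 holds the one-block partition by \<open>set_partitions_first\<close>,
    and the forests consistent with it are the spanning trees.\<close>
  have "int (card {T. spanning_tree T (cartesian_product G (path_graph n))}) =
      (transfer_mat ^\<^sub>m n *\<^sub>v initial_vec) $ 0" if "n \<ge> 1" for n
    using pow[OF that Bell_pos] set_partitions_first[OF assms(1)] spanning_tree_iff[OF that] by simp
  then show ?thesis
    using pow by (intro exI[of _ transfer_mat] exI[of _ initial_vec])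
      (auto simp: transfer_mat_def initial_vec_def)
qed

end
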